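(* Let $\Gamma=(V,T,\mathbf{s},\mathbf{r})$ be a network. Then the semigroup $Q_\Gamma$ is a right $*$-abundant semigroup with a zero.
   Context: A network $\Gamma=(V,T,\mathbf{s},\mathbf{r})$ consists of a set $V$ of vertices, a set $T$ of relations, and maps $\mathbf{s},\mathbf{r}:T\to\mathcal{P}(V)$ (source and range) such that for every $t\in T$ the sets $\mathbf{s}(t)$ and $\mathbf{r}(t)$ are disjoint non-empty subsets of $V$; $V$ and $T$ are finite or countably infinite. A vertex $v$ is identified with the singleton $\{v\}$. Put $T^0=\{A\subseteq V: A=\mathbf{s}(t)\text{ or }A=\mathbf{r}(t)\text{ for some }t\in T\}\cup V$, and set $\mathbf{s}(A)=A=\mathbf{r}(A)$ for $A\in T^0$. For each $t\in T$ let $t^{-1}$ be a formal symbol with $\mathbf{s}(t^{-1})=\mathbf{r}(t)$, $\mathbf{r}(t^{-1})=\mathbf{s}(t)$; put $A^{-1}=A$ for $A\in T^0$ and $T^{-1}=\{t^{-1}:t\in T\}$. The symbol sets $T$, $T^0$, $T^{-1}$, $\{0\}$ are pairwise disjoint. $Q_\Gamma$ is the semigroup generated by $X=T\cup T^0\cup T^{-1}\cup\{0\}$ subject to the relations: (NR1) $\mathbf{s}(t)t=t=t\mathbf{r}(t)$ for $t\in T\cup T^0\cup T^{-1}$; (NR2) $t_1t_2=0$ if $\mathbf{r}(t_1)\cap\mathbf{s}(t_2)=\emptyset$, for $t_1,t_2\in T\cup T^0\cup T^{-1}$; (NR3) $t_1^{-1}t_2=0$ if $t_1\neq t_2$, for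 $t_1,t_2\in T$; (NR4) $t^{-1}t=\mathbf{r}(t)$ for $t\in T$; (NR5) $t^{-1}A=0$ if $\mathbf{s}(t)\neq A$, for $t\in T$, $A\in T^0$; (NR6) $0x=0=x0$ for all $x\in X$. (Here, for $A,B\in T^0$, $AB$ is a word, not the intersection.) For elements $a,b$ of a semigroup $S$, $a\,\mathcal{L}^*\,b$ means: for all $x,y\in S^1$, $ax=ay\Leftrightarrow bx=by$. A semigroup is right $*$-abundant if each $\mathcal{L}^*$-class contains a unique idempotent. *)

theory Defs
  imports "HOL-Algebra.Congruence" "HOL-Library.Countable_Set"
begin

section \<open>Semigroups on a carrier set\<close>

record 'a sgrp = "'a partial_object" +
  mul :: "'a \<Rightarrow> 'a \<Rightarrow> 'a" (infixl "\<odot>\<index>" 70)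

locale sgrp =
  fixes S :: "('a, 'm) sgrp_scheme" (structure)
  assumes mul_closed: "x \<in> carrier S \<Longrightarrow> y \<in> carrier S \<Longrightarrow> x \<odot> y \<in> carrier S"
    and mul_assoc: "x \<in> carrier S \<Longrightarrow> y \<in> carrier S \<Longrightarrow> z \<in> carrier S \<Longrightarrow>
      (x \<odot> y) \<odot> z = x \<odot> (y \<odot> z)"

definition is_zero :: "('a, 'm) sgrp_scheme \<Rightarrow> 'a \<Rightarrow> bool" where
  "is_zero S z \<longleftrightarrow> z \<in> carrier S \<and> (\<forall>x \<in> carrier S. z \<odot>\<^bsub>S\<^esub> x = z \<and> x \<odot>\<^bsub>S\<^esub> z = z)"

definition is_identity :: "('a, 'm) sgrp_scheme \<Rightarrow> 'a \<Rightarrow> bool" where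
  "is_identity S e \<longleftrightarrow> e \<in> carrier S \<and> (\<forall>x \<in> carrier S. e \<odot>\<^bsub>S\<^esub> x = x \<and> x \<odot>\<^bsub>S\<^esub> e = x)"

definition idempotents :: "('a, 'm) sgrp_scheme \<Rightarrow> 'a set" where
  "idempotents S = {e \<in> carrier S. e \<odot>\<^bsub>S\<^esub> e = e}"

text \<open>
  The monoid $S^1$ is $S$ itself if $S$ has an identity, and $S$ with a new identity adjoined
  otherwise. Its elements have type \<open>'a option\<close>: \<open>Some\<close> embeds $S$ and \<open>None\<close> is the
  adjoined identity.
\<close>

definition adjoin_one :: "('a, 'm) sgrp_scheme \<Rightarrow> 'a option sgrp" where
  "adjoin_one S =
    \<lparr> carrier = Some ` carrier S \<union> (if \<exists>e. is_identity S e then {} else {None}),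
      mul = (\<lambda>x y. case x of None \<Rightarrow> y
        | Some a \<Rightarrow> (case y of None \<Rightarrow> Some a | Some b \<Rightarrow> Some (a \<odot>\<^bsub>S\<^esub> b))) \<rparr>"

definition Lstar :: "('a, 'm) sgrp_scheme \<Rightarrow> 'a rel" where
  "Lstar S = {(a, b). a \<in> carrier S \<and> b \<in> carrier S \<and>
    (\<forall>x \<in> carrier (adjoin_one S). \<forall>y \<in> carrier (adjoin_one S).
      Some a \<odot>\<^bsub>adjoin_one S\<^esub> x = Some a \<odot>\<^bsub>adjoin_one S\<^esub> y \<longleftrightarrow>
      Some b \<odot>\<^bsub>adjoin_one S\<^esub> x = Some b \<odot>\<^bsub>adjoin_one S\<^esub> y)}"

definition right_star_abundant :: "('a, 'm) sgrp_scheme \<Rightarrow> bool" where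
  "right_star_abundant S \<longleftrightarrow> sgrp S \<and> (\<forall>C \<in> carrier S // Lstar S. \<exists>!e. e \<in> C \<inter> idempotents S)"


section \<open>Semigroup presentations\<close>

definition words :: "'x set \<Rightarrow> 'x list set" where
  "words X = lists X - {[]}"

inductive_set gen_cong :: "'x set \<Rightarrow> 'x list rel \<Rightarrow> 'x list rel"
  for X :: "'x set" and R :: "'x list rel"
  where
    base: "(u, v) \<in> R \<Longrightarrow> u \<in> words X \<Longrightarrow> v \<in> words X \<Longrightarrow> (u, v) \<in> gen_cong X R"
  | refl: "u \<in> words X \<Longrightarrow> (u, u) \<in> gen_cong X R"
  | sym: "(u, v) \<in> gen_cong X R \<Longrightarrow> (v, u) \<in> gen_cong X R"
  | trans: "(u, v) \<in> gen_cong X R \<Longrightarrow> (v, w) \<in> gen_cong X R \<Longrightarrow> (u, w) \<in> gen_cong X R"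
  | append: "(u, v) \<in> gen_cong X R \<Longrightarrow> (u', v') \<in> gen_cong X R \<Longrightarrow>
      (u @ u', v @ v') \<in> gen_cong X R"

definition presented_sgrp :: "'x set \<Rightarrow> 'x list rel \<Rightarrow> 'x list set sgrp" where
  "presented_sgrp X R =
    \<lparr> carrier = words X // gen_cong X R,
      mul = (\<lambda>A B. \<Union>u \<in> A. \<Union>v \<in> B. gen_cong X R `` {u @ v}) \<rparr>"

lemma words_append: "u \<in> words X \<Longrightarrow> v \<in> words X \<Longrightarrow> u @ v \<in> words X"
  by (auto simp: words_def)

lemma gen_cong_words: "(u, v) \<in> gen_cong X R \<Longrightarrow> u \<in> words X \<and> v \<in> words X"
  by (induction rule: gen_cong.induct) (auto intro: words_append)

lemma equiv_gen_cong: "equiv (words X) (gen_cong X R)"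
  by (rule equivI)
    (auto simp: refl_on_def sym_def trans_def
      dest: gen_cong_words intro: gen_cong.refl gen_cong.sym gen_cong.trans)

lemma presented_sgrp_mul:
  assumes "u \<in> words X" "v \<in> words X"
  shows "gen_cong X R `` {u} \<odot>\<^bsub>presented_sgrp X R\<^esub> gen_cong X R `` {v} = gen_cong X R `` {u @ v}"
proof -
  have "congruent2 (gen_cong X R) (gen_cong X R) (\<lambda>u v. gen_cong X R `` {u @ v})"
    by (auto simp: congruent2_def intro!: equiv_class_eq[OF equiv_gen_cong] gen_cong.append)
  then show ?thesis
    using UN_equiv_class2[OF equiv_gen_cong equiv_gen_cong] assms
    by (simp add: presented_sgrp_def)
qed


section \<open>Networks\<close>

locale network =
  fixes V :: "'v set" and T :: "'t set" and s r :: "'t \<Rightarrow> 'v set"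
  assumes s_subset: "t \<in> T \<Longrightarrow> s t \<subseteq> V"
    and r_subset: "t \<in> T \<Longrightarrow> r t \<subseteq> V"
    and s_nonempty: "t \<in> T \<Longrightarrow> s t \<noteq> {}"
    and r_nonempty: "t \<in> T \<Longrightarrow> r t \<noteq> {}"
    and s_r_disjoint: "t \<in> T \<Longrightarrow> s t \<inter> r t = {}"
    and countable_V: "countable V"
    and countable_T: "countable T"

definition T0 :: "'v set \<Rightarrow> 't set \<Rightarrow> ('t \<Rightarrow> 'v set) \<Rightarrow> ('t \<Rightarrow> 'v set) \<Rightarrow> 'v set set" where
  "T0 V T s r = {A. A \<subseteq> V \<and> (\<exists>t \<in> T. A = s t \<or> A = r t)} \<union> (\<lambda>v. {v}) ` V"

datatype ('v, 't) letter = Rel 't | Obj "'v set" | Inv 't | Zero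

definition letters ::
  "'v set \<Rightarrow> 't set \<Rightarrow> ('t \<Rightarrow> 'v set) \<Rightarrow> ('t \<Rightarrow> 'v set) \<Rightarrow> ('v, 't) letter set" where
  "letters V T s r = Rel ` T \<union> Obj ` T0 V T s r \<union> Inv ` T \<union> {Zero}"

text \<open>
  The values of \<open>src\<close> and \<open>rng\<close> at \<open>Zero\<close> are dummies; they are not used below.
\<close>

fun src :: "('t \<Rightarrow> 'v set) \<Rightarrow> ('t \<Rightarrow> 'v set) \<Rightarrow> ('v, 't) letter \<Rightarrow> 'v set" where
  "src s r (Rel t) = s t"
| "src s r (Obj A) = A"
| "src s r (Inv t) = r t"
| "src s r Zero = {}"

fun rng :: "('t \<Rightarrow> 'v set) \<Rightarrow> ('t \<Rightarrow> 'v set) \<Rightarrow> ('v, 't) letter \<Rightarrow> 'v set" where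
  "rng s r (Rel t) = r t"
| "rng s r (Obj A) = A"
| "rng s r (Inv t) = s t"
| "rng s r Zero = {}"

inductive_set network_rels ::
  "'v set \<Rightarrow> 't set \<Rightarrow> ('t \<Rightarrow> 'v set) \<Rightarrow> ('t \<Rightarrow> 'v set) \<Rightarrow> ('v, 't) letter list rel"
  for V :: "'v set" and T :: "'t set" and s r :: "'t \<Rightarrow> 'v set"
  where
    NR1_src: "x \<in> letters V T s r - {Zero} \<Longrightarrow> ([Obj (src s r x), x], [x]) \<in> network_rels V T s r"
  | NR1_rng: "x \<in> letters V T s r - {Zero} \<Longrightarrow> ([x, Obj (rng s r x)], [x]) \<in> network_rels V T s r"
  | NR2: "x \<in> letters V T s r - {Zero} \<Longrightarrow> y \<in> letters V T s r - {Zero} \<Longrightarrow>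
      rng s r x \<inter> src s r y = {} \<Longrightarrow> ([x, y], [Zero]) \<in> network_rels V T s r"
  | NR3: "t \<in> T \<Longrightarrow> u \<in> T \<Longrightarrow> t \<noteq> u \<Longrightarrow> ([Inv t, Rel u], [Zero]) \<in> network_rels V T s r"
  | NR4: "t \<in> T \<Longrightarrow> ([Inv t, Rel t], [Obj (r t)]) \<in> network_rels V T s r"
  | NR5: "t \<in> T \<Longrightarrow> A \<in> T0 V T s r \<Longrightarrow> s t \<noteq> A \<Longrightarrow>
      ([Inv t, Obj A], [Zero]) \<in> network_rels V T s r"
  | NR6_left: "x \<in> letters V T s r \<Longrightarrow> ([Zero, x], [Zero]) \<in> network_rels V T s r"
  | NR6_right: "x \<in> letters V T s r \<Longrightarrow> ([x, Zero], [Zero]) \<in> network_rels V T s r"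

definition Q ::
  "'v set \<Rightarrow> 't set \<Rightarrow> ('t \<Rightarrow> 'v set) \<Rightarrow> ('t \<Rightarrow> 'v set) \<Rightarrow> ('v, 't) letter list set sgrp" where
  "Q V T s r = presented_sgrp (letters V T s r) (network_rels V T s r)"

end

theory Submission
  imports Defs
begin

text \<open>
  The word problem of the presentation is solved by a length-reducing rewriting system: every
  defining relation replaces a two-letter word by a single letter, and adding the derived rules
  \<open>t\<^sup>-\<^sup>1 u\<^sup>-\<^sup>1 \<rightarrow> 0\<close> for \<open>s(t) \<noteq> r(u)\<close> makes the system confluent. So every element of the
  network semigroup has a unique reduced representative (\<open>gen_cong_iff_nf\<close>), and questions about
  the semigroup become questions about reduced words.

  Two elements \<open>a\<close>, \<open>b\<close> are \<open>\<L>\<^sup>*\<close>-related when left multiplication by \<open>a\<close> and by \<open>b\<close>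
  identifies the same pairs. Take a non-zero reduced word. Only inverse letters can follow an
  inverse letter, so the word consists of relations and vertex sets, followed by some
  \<open>v = t\<^sub>1\<^sup>-\<^sup>1 \<dots> t\<^sub>k\<^sup>-\<^sup>1\<close>. A leading relation \<open>t\<close> is left cancellable up to \<open>r(t)\<close>, because
  \<open>t\<^sup>-\<^sup>1 t = r(t)\<close>; a leading vertex set \<open>A\<close> in front of something non-zero either acts as an
  identity or is just written down in front of the reduced word that follows it. Both can be
  stripped without leaving the \<open>\<L>\<^sup>*\<close>-class, until the last vertex set or the word \<open>v\<close> is left.
  Finally \<open>v\<close> and \<open>v\<^sup>* v\<close>, with \<open>v\<^sup>* = t\<^sub>k \<dots> t\<^sub>1\<close>, are left multiples of each other. Thus every
  class contains \<open>0\<close>, some \<open>A\<close>, or some \<open>v\<^sup>* v\<close>, all of which are idempotent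
  (\<open>same_kernel_basic_idempotent\<close>).

  For uniqueness, two \<open>\<L>\<^sup>*\<close>-related idempotents satisfy \<open>f e = f\<close> and \<open>e f = e\<close>. If
  \<open>e = v\<^sup>* v\<close>, the second equation gives \<open>v f = v\<close>, hence \<open>v (f v\<^sup>*) = v v\<^sup>*\<close>. The right-hand side
  is the single vertex set \<open>r(t\<^sub>1)\<close>, and inverse letters can only have been absorbed completely
  if \<open>f v\<^sup>*\<close> is \<open>v\<^sup>* v v\<^sup>*\<close> (\<open>nf_Invs_solve\<close>); multiplying by \<open>v\<close> gives \<open>f = e\<close>
  (\<open>basic_idempotent_unique\<close>).
\<close>

section \<open>Semigroups given by presentations\<close>

lemma sgrp_presented_sgrp: "sgrp (presented_sgrp X R)"
proof
  fix x y z
  let ?S = "presented_sgrp X R" and ?c = "\<lambda>u. gen_cong X R `` {u}"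
  have carrier_iff: "a \<in> carrier ?S \<longleftrightarrow> (\<exists>u\<in>words X. a = ?c u)" for a
    by (auto simp: presented_sgrp_def quotient_def)
  assume "x \<in> carrier ?S" "y \<in> carrier ?S"
  then obtain u v where uv: "u \<in> words X" "v \<in> words X" "x = ?c u" "y = ?c v"
    by (auto simp: carrier_iff)
  then show "x \<odot>\<^bsub>?S\<^esub> y \<in> carrier ?S"
    by (auto simp: presented_sgrp_mul carrier_iff intro: words_append)
  assume "z \<in> carrier ?S"
  then obtain w where "w \<in> words X" "z = ?c w"
    by (auto simp: carrier_iff)
  with uv show "(x \<odot>\<^bsub>?S\<^esub> y) \<odot>\<^bsub>?S\<^esub> z = x \<odot>\<^bsub>?S\<^esub> (y \<odot>\<^bsub>?S\<^esub> z)"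
    by (simp add: presented_sgrp_mul words_append)
qed

text \<open>
  Since \<open>e e = e 1\<close>, being \<open>\<L>\<^sup>*\<close>-related forces \<open>f e = f 1\<close>. The identity of \<open>S\<^sup>1\<close> may already
  lie in \<open>S\<close>, whence the case distinction.
\<close>

lemma Lstar_idempotent_right_identity:
  assumes "(e, f) \<in> Lstar S" "e \<in> idempotents S"
  shows "f \<odot>\<^bsub>S\<^esub> e = f"
proof -
  have e: "e \<in> carrier S" "e \<odot>\<^bsub>S\<^esub> e = e" and f: "f \<in> carrier S"
    using assms by (auto simp: idempotents_def Lstar_def)
  have L: "Some e \<odot>\<^bsub>adjoin_one S\<^esub> x = Some e \<odot>\<^bsub>adjoin_one S\<^esub> y \<longleftrightarrow>
      Some f \<odot>\<^bsub>adjoin_one S\<^esub> x = Some f \<odot>\<^bsub>adjoin_one S\<^esub> y"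
    if "x \<in> carrier (adjoin_one S)" "y \<in> carrier (adjoin_one S)" for x y
    using assms(1) that by (auto simp: Lstar_def)
  show ?thesis
  proof (cases "\<exists>i. is_identity S i")
    case True
    then obtain i where "is_identity S i" by blast
    then show ?thesis
      using L[of "Some e" "Some i"] e f by (auto simp: adjoin_one_def is_identity_def)
  next
    case False
    then show ?thesis
      using L[of "Some e" None] e f by (auto simp: adjoin_one_def)
  qed
qed

context network
begin

section \<open>Reduction of words\<close>

abbreviation X :: "('v, 't) letter set" where
  "X \<equiv> letters V T s r"

text \<open>
  One reduction step on two adjacent letters, \<open>None\<close> meaning that they are left alone. The test
  on disjointness also catches \<open>Zero\<close>, whose source and range are empty. The last branch goes
  beyond the defining relations in one case: it sends \<open>t\<^sup>-\<^sup>1 u\<^sup>-\<^sup>1\<close> to zero if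
  \<open>s(t) \<noteq> r(u)\<close>, even if these sets intersect. This is forced by \<open>t\<^sup>-\<^sup>1 u\<^sup>-\<^sup>1 = t\<^sup>-\<^sup>1 r(u) u\<^sup>-\<^sup>1 = 0\<close> and is needed for confluence.
\<close>

definition red :: "('v, 't) letter \<Rightarrow> ('v, 't) letter \<Rightarrow> ('v, 't) letter option" where
  "red x y =
    (if rng s r x \<inter> src s r y = {} then Some Zero
     else if x = Obj (src s r y) then Some y
     else if y = Obj (rng s r x) then Some x
     else case x of
       Inv t \<Rightarrow>
         (if y = Rel t then Some (Obj (r t))
          else if (\<exists>u. y = Inv u) \<and> src s r y = s t then None
          else Some Zero)
     | _ \<Rightarrow> None)"

text \<open>
  Left multiplication of a reduced word by a letter. After a step the new letter may react with
  the rest: in \<open>t\<^sup>-\<^sup>1 s(t) x\<close>, the pair \<open>t\<^sup>-\<^sup>1 x\<close> reduces although \<open>s(t) x\<close> does not.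
\<close>

fun act :: "('v, 't) letter \<Rightarrow> ('v, 't) letter list \<Rightarrow> ('v, 't) letter list" where
  "act x [] = [x]"
| "act x (y # w) = (case red x y of None \<Rightarrow> x # y # w | Some z \<Rightarrow> act z w)"

abbreviation nf :: "('v, 't) letter list \<Rightarrow> ('v, 't) letter list" where
  "nf u \<equiv> foldr act u []"

abbreviation irred :: "('v, 't) letter list \<Rightarrow> bool" where
  "irred \<equiv> successively (\<lambda>x y. red x y = None)"

lemma src_rng_nonempty:
  assumes "x \<in> X" "x \<noteq> Zero"
  shows "src s r x \<noteq> {}" "rng s r x \<noteq> {}"
  using assms s_nonempty r_nonempty by (auto simp: letters_def T0_def)

lemma letters_simps [simp]:
  "Rel t \<in> X \<longleftrightarrow> t \<in> T" "Inv t \<in> X \<longleftrightarrow> t \<in> T" "Zero \<in> X"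
  "Obj A \<in> X \<longleftrightarrow> A \<in> T0 V T s r"
  by (auto simp: letters_def)

lemma Obj_src_rng_in_X:
  assumes "x \<in> X" "x \<noteq> Zero"
  shows "Obj (src s r x) \<in> X" "Obj (rng s r x) \<in> X"
  using assms s_subset r_subset by (cases x; auto simp: T0_def)+

lemma T0_source_range [simp]: "t \<in> T \<Longrightarrow> s t \<in> T0 V T s r" "t \<in> T \<Longrightarrow> r t \<in> T0 V T s r"
  using s_subset r_subset by (auto simp: T0_def)

lemma red_Zero [simp]: "red Zero y = Some Zero" "red x Zero = Some Zero"
  by (simp_all add: red_def)

lemma red_in_X: "x \<in> X \<Longrightarrow> y \<in> X \<Longrightarrow> red x y = Some z \<Longrightarrow> z \<in> X"
  by (auto simp: red_def split: if_splits letter.splits)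

lemma red_src: "red x y = Some z \<Longrightarrow> z = Zero \<or> src s r z = src s r x"
  by (auto simp: red_def split: if_splits letter.splits)

lemma red_Obj:
  "red (Obj A) y = (if A \<inter> src s r y = {} then Some Zero else if A = src s r y then Some y else None)"
  by (auto simp: red_def)

lemma red_Rel:
  "red (Rel t) y = (if r t \<inter> src s r y = {} then Some Zero else if y = Obj (r t) then Some (Rel t) else None)"
  by (auto simp: red_def)

lemma red_Inv:
  assumes "t \<in> T"
  shows "red (Inv t) y =
    (if src s r y \<noteq> s t then Some Zero
     else case y of Obj A \<Rightarrow> Some (Inv t) | Inv u \<Rightarrow> None
       | Rel u \<Rightarrow> if t = u then Some (Obj (r t)) else Some Zero | Zero \<Rightarrow> Some Zero)"
  using s_nonempty[OF assms] by (cases y) (auto simp: red_def)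

text \<open>
  The critical pairs \<open>x y a\<close> with both halves reducible. Either both sides shrink to the same
  letter, or both steps just drop the vertex set \<open>y\<close>, leaving the same two letters \<open>x a\<close>. What
  makes it work is that a step with non-zero result keeps the outer source and range, so that
  steps to zero on one side are still available after a step on the other.
\<close>

lemma red_locally_confluent:
  assumes "x \<in> X" "y \<in> X" "a \<in> X" "red x y = Some z" "red y a = Some b"
  shows "(\<exists>c. red x b = Some c \<and> red z a = Some c) \<or> (z = x \<and> b = a)"
proof (cases "y = Zero")
  case True
  then show ?thesis using assms by auto
next
  case y: False
  have src_y: "src s r y \<noteq> {}" using src_rng_nonempty assms y by blast
  show ?thesis
  proof (cases x)
    case (Rel t)
    show ?thesis
    proof (cases y)
      case (Obj B)
      then show ?thesis using assms Rel src_y by (auto simp: red_Obj red_Rel split: if_splits)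
    qed (use assms Rel red_src[of y a b] src_y in \<open>auto simp: red_Rel split: if_splits\<close>)
  next
    case (Obj A)
    show ?thesis using assms Obj red_src[of y a b] src_y by (auto simp: red_Obj split: if_splits)
  next
    case (Inv t)
    then have t: "t \<in> T" using assms by simp
    show ?thesis
    proof (cases y)
      case (Rel u)
      have "z = Zero \<or> u = t \<and> z = Obj (r t)"
        using assms(4) Inv Rel t by (auto simp: red_Inv split: if_splits)
      moreover have "b = Zero \<or> b = Rel u \<and> a = Obj (r u)" "b = Zero \<Longrightarrow> r u \<inter> src s r a = {}"
        using assms(5) Rel by (auto simp: red_Rel split: if_splits)
      ultimately show ?thesis
        using assms(4) Inv Rel src_y r_nonempty[OF t] by (elim disjE conjE) (simp_all add: red_Obj)
    next
      case (Obj B)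
      have "z = Zero \<and> B \<noteq> s t \<or> z = Inv t \<and> B = s t"
        using assms(4) Inv Obj t by (auto simp: red_Inv split: if_splits)
      moreover have "b = Zero \<and> B \<inter> src s r a = {} \<or> b = a \<and> B = src s r a"
        using assms(5) Obj by (auto simp: red_Obj split: if_splits)
      ultimately show ?thesis
        using Inv Obj src_y t by (elim disjE conjE) (simp_all add: red_Inv, blast)
    next
      case Inv': (Inv u)
      have "z = Zero" "s t \<noteq> r u"
        using assms(4) Inv Inv' t by (auto simp: red_Inv split: if_splits)
      moreover have "red (Inv t) b = Some Zero"
      proof (cases "b = Zero")
        case False
        then have "src s r b = r u" using red_src[OF assms(5)] Inv' by simp
        then show ?thesis using \<open>s t \<noteq> r u\<close> red_Inv[OF t, of b] by simp
      qed simp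
      ultimately show ?thesis using Inv by simp
    qed (use y in simp)
  next
    case Zero
    then show ?thesis using assms by auto
  qed
qed

lemma act_in_X: "x \<in> X \<Longrightarrow> w \<in> lists X \<Longrightarrow> act x w \<in> lists X"
  by (induction w arbitrary: x) (auto split: option.split dest: red_in_X)

lemma foldr_act_in_X: "u \<in> lists X \<Longrightarrow> w \<in> lists X \<Longrightarrow> foldr act u w \<in> lists X"
  by (induction u) (simp_all add: act_in_X)

lemma act_nonempty [simp]: "act x w \<noteq> []"
  by (induction w arbitrary: x) (auto split: option.split)

lemma irred_act: "irred w \<Longrightarrow> irred (act x w)"
  by (induction w arbitrary: x) (auto simp: successively_Cons split: option.split)

lemma irred_foldr_act: "irred w \<Longrightarrow> irred (foldr act u w)"
  by (induction u) (auto intro: irred_act)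

lemma act_Zero [simp]: "act Zero w = [Zero]"
  by (induction w) auto

lemma act_irred: "irred (x # w) \<Longrightarrow> act x w = x # w"
  by (cases w) auto

lemma nf_irred: "irred w \<Longrightarrow> nf w = w"
  by (induction w) (auto simp: act_irred successively_Cons)

text \<open>
  Products in this semigroup remember the source of their first factor, unless they vanish.
\<close>

lemma act_src: "act x w = [Zero] \<or> src s r (hd (act x w)) = src s r x"
proof (induction w arbitrary: x)
  case (Cons y w)
  show ?case
  proof (cases "red x y")
    case (Some z)
    then have "act x (y # w) = act z w" by simp
    then show ?thesis using red_src[OF Some] Cons.IH[of z] act_Zero by metis
  qed simp
qed simp

text \<open>
  The letters act on reduced words in accordance with the rewriting rules. This is the passage
  from local confluence to uniqueness of normal forms: the critical pair with the first letter
  of \<open>w\<close> is resolved and the induction hypothesis does the rest.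
\<close>

lemma act_red:
  assumes "red x y = Some z" "x \<in> X" "y \<in> X" "w \<in> lists X" "irred w"
  shows "act x (act y w) = act z w"
  using assms
proof (induction w arbitrary: x y z)
  case Nil
  then show ?case by simp
next
  case (Cons a w)
  then have a: "a \<in> X" and w: "w \<in> lists X" "irred w"
    by (auto simp: successively_Cons)
  show ?case
  proof (cases "red y a")
    case None
    then show ?thesis using Cons.prems by simp
  next
    case (Some b)
    have b: "b \<in> X" using red_in_X Some Cons.prems(3) a by blast
    from red_locally_confluent[OF Cons.prems(2,3) a Cons.prems(1) Some]
    consider c where "red x b = Some c" "red z a = Some c" | "z = x" "b = a"
      by blast
    then show ?thesis
    proof cases
      case 1
      then show ?thesis using Cons.IH Some w Cons.prems(2) b by simp
    next
      case 2
      then have "act y (a # w) = a # w"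
        using Some Cons.prems(5) by (simp add: act_irred)
      then show ?thesis using 2 by simp
    qed
  qed
qed

lemma foldr_act_act:
  assumes "x \<in> X" "u \<in> lists X" "w \<in> lists X" "irred w"
  shows "foldr act (act x u) w = act x (foldr act u w)"
  using assms
proof (induction u arbitrary: x)
  case Nil
  then show ?case by simp
next
  case (Cons y u)
  then have u: "foldr act u w \<in> lists X" "irred (foldr act u w)"
    by (auto intro: irred_foldr_act simp: foldr_act_in_X)
  show ?case
    using Cons u by (auto split: option.split simp: act_red dest: red_in_X)
qed

text \<open>
  A word acts in the same way as its normal form, so that multiplication passes to normal forms.
\<close>

lemma foldr_act_nf:
  assumes "u \<in> lists X" "w \<in> lists X" "irred w"
  shows "foldr act (nf u) w = foldr act u w"
  using assms by (induction u) (auto simp: foldr_act_act foldr_act_in_X)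

lemma nf_in_X: "u \<in> lists X \<Longrightarrow> nf u \<in> lists X"
  by (simp add: foldr_act_in_X)

lemma irred_nf: "irred (nf u)"
  by (simp add: irred_foldr_act)

lemma nf_append:
  assumes "u \<in> lists X" "v \<in> lists X"
  shows "nf (u @ v) = foldr act (nf u) (nf v)"
  using foldr_act_nf[OF assms(1) nf_in_X[OF assms(2)] irred_nf] by simp

lemma nf_cong:
  assumes "nf u = nf u'" "nf v = nf v'" "u \<in> lists X" "u' \<in> lists X" "v \<in> lists X" "v' \<in> lists X"
  shows "nf (u @ v) = nf (u' @ v')"
  using assms by (simp only: nf_append)

section \<open>Reduced words are normal forms\<close>

abbreviation R :: "('v, 't) letter list rel" where
  "R \<equiv> network_rels V T s r"

lemma words_iff: "u \<in> words X \<longleftrightarrow> u \<in> lists X \<and> u \<noteq> []"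
  by (auto simp: words_def)

lemma network_rels_red:
  assumes "(u, v) \<in> R"
  shows "\<exists>x\<in>X. \<exists>y\<in>X. \<exists>z. u = [x, y] \<and> v = [z] \<and> red x y = Some z"
  using assms
proof cases
  case (NR1_src x)
  then show ?thesis
    using src_rng_nonempty[of x] Obj_src_rng_in_X[of x] by (auto simp: red_def)
next
  case (NR1_rng x)
  then show ?thesis
    using src_rng_nonempty[of x] Obj_src_rng_in_X[of x] by (auto simp: red_def)
next
  case (NR4 t)
  then show ?thesis
    using s_nonempty[of t] by (auto simp: red_def)
qed (auto simp: red_def)

lemma red_gen_cong:
  assumes "x \<in> X" "y \<in> X" "red x y = Some z"
  shows "([x, y], [z]) \<in> gen_cong X R"
proof -
  have rel: "(u, v) \<in> gen_cong X R" if "(u, v) \<in> R" "u \<in> lists X" "v \<in> lists X" "u \<noteq> []" "v \<noteq> []" for u v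
    using that by (auto intro: gen_cong.base simp: words_iff)
  consider "x = Zero" | "y = Zero"
    | "x \<noteq> Zero" "y \<noteq> Zero" "rng s r x \<inter> src s r y = {}" "z = Zero"
    | "y \<noteq> Zero" "x = Obj (src s r y)" "z = y"
    | "x \<noteq> Zero" "y = Obj (rng s r x)" "z = x"
    | t where "x = Inv t" "y = Rel t" "z = Obj (r t)"
    | t u where "x = Inv t" "y = Rel u" "t \<noteq> u" "z = Zero"
    | t A where "x = Inv t" "y = Obj A" "A \<noteq> s t" "z = Zero"
    | t u where "x = Inv t" "y = Inv u" "r u \<noteq> s t" "z = Zero"
    using assms(3) by (cases x; cases y) (auto simp: red_def split: if_splits)
  then show ?thesis
  proof cases
    case (9 t u)
    (* The one rule that is not a defining relation: insert r(u) between the two inverses. *)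
    have tu: "t \<in> T" "u \<in> T" using 9 assms by auto
    have "([Inv u], [Obj (r u), Inv u]) \<in> gen_cong X R"
      using tu by (auto intro!: gen_cong.sym[OF rel] network_rels.NR1_src[of "Inv u", simplified])
    then have "([Inv t] @ [Inv u], [Inv t] @ [Obj (r u), Inv u]) \<in> gen_cong X R"
      using tu by (intro gen_cong.append gen_cong.refl) (auto simp: words_iff)
    moreover have "([Inv t, Obj (r u)] @ [Inv u], [Zero] @ [Inv u]) \<in> gen_cong X R"
      using tu 9 by (intro gen_cong.append gen_cong.refl rel) (auto simp: words_iff intro!: network_rels.NR5)
    moreover have "([Zero, Inv u], [Zero]) \<in> gen_cong X R"
      using tu by (intro rel) (auto intro: network_rels.NR6_left)
    ultimately show ?thesis using 9 by (auto intro: gen_cong.trans)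
  next
    case 1 then show ?thesis using assms by (auto intro!: rel network_rels.intros)
  next
    case 2 then show ?thesis using assms by (auto intro!: rel network_rels.intros)
  next
    case 3 then show ?thesis using assms by (auto intro!: rel network_rels.NR2)
  next
    case 4 then show ?thesis using assms by (auto intro!: rel network_rels.NR1_src)
  next
    case 5 then show ?thesis using assms by (auto intro!: rel network_rels.NR1_rng)
  next
    case 6 then show ?thesis using assms by (auto intro!: rel network_rels.NR4)
  next
    case 7 then show ?thesis using assms by (auto intro!: rel network_rels.NR3)
  next
    case 8 then show ?thesis using assms by (auto intro!: rel network_rels.NR5)
  qed
qed

lemma act_gen_cong:
  assumes "x \<in> X" "w \<in> lists X"
  shows "(x # w, act x w) \<in> gen_cong X R"
  using assms
proof (induction w arbitrary: x)
  case Nil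
  then show ?case by (auto intro: gen_cong.refl simp: words_iff)
next
  case (Cons y w)
  then have y: "y \<in> X" and w: "w \<in> lists X" by auto
  show ?case
  proof (cases "red x y")
    case None
    then show ?thesis using Cons.prems by (auto intro: gen_cong.refl simp: words_iff)
  next
    case (Some z)
    have z: "z \<in> X" using Some red_in_X Cons.prems y by blast
    have "(x # y # w, z # w) \<in> gen_cong X R"
    proof (cases "w = []")
      case True
      then show ?thesis using red_gen_cong Cons.prems y Some by simp
    next
      case False
      then have "([x, y] @ w, [z] @ w) \<in> gen_cong X R"
        using red_gen_cong Cons.prems y Some w
        by (intro gen_cong.append gen_cong.refl) (auto simp: words_iff)
      then show ?thesis by simp
    qed
    then show ?thesis using Cons.IH[OF z w] Some by (auto intro: gen_cong.trans)
  qed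
qed

lemma nf_gen_cong:
  assumes "u \<in> words X"
  shows "(u, nf u) \<in> gen_cong X R"
  using assms
proof (induction u)
  case Nil
  then show ?case by (simp add: words_iff)
next
  case (Cons x u)
  then have x: "x \<in> X" and u: "u \<in> lists X" by (auto simp: words_iff)
  have "(x # u, x # nf u) \<in> gen_cong X R"
  proof (cases "u = []")
    case True
    then show ?thesis using Cons.prems by (auto intro: gen_cong.refl)
  next
    case False
    then have "([x] @ u, [x] @ nf u) \<in> gen_cong X R"
      using Cons x u by (intro gen_cong.append gen_cong.refl) (auto simp: words_iff)
    then show ?thesis by simp
  qed
  then show ?case using act_gen_cong[OF x nf_in_X[OF u]] by (auto intro: gen_cong.trans)
qed

lemma gen_cong_nf: "(u, v) \<in> gen_cong X R \<Longrightarrow> nf u = nf v"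
proof (induction rule: gen_cong.induct)
  case (base u v)
  then show ?case using network_rels_red[of u v] by auto
next
  case (append u v u' v')
  then show ?case using nf_cong[of u v u' v'] by (auto dest!: gen_cong_words simp: words_iff)
qed auto

lemma gen_cong_iff_nf:
  assumes "u \<in> words X" "v \<in> words X"
  shows "(u, v) \<in> gen_cong X R \<longleftrightarrow> nf u = nf v"
  using assms gen_cong_nf nf_gen_cong gen_cong.sym gen_cong.trans by metis

section \<open>Elements with the same left kernel\<close>

text \<open>
  The relation \<open>\<L>\<^sup>*\<close> on the level of words; the empty words \<open>x\<close>, \<open>y\<close> play the part of the
  adjoined identity.
\<close>

definition same_kernel :: "('v, 't) letter list \<Rightarrow> ('v, 't) letter list \<Rightarrow> bool" where
  "same_kernel a b \<longleftrightarrow>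
    (\<forall>x\<in>lists X. \<forall>y\<in>lists X. nf (a @ x) = nf (a @ y) \<longleftrightarrow> nf (b @ x) = nf (b @ y))"

lemma same_kernel_refl: "same_kernel a a"
  by (simp add: same_kernel_def)

lemma same_kernel_trans: "same_kernel a b \<Longrightarrow> same_kernel b c \<Longrightarrow> same_kernel a c"
  by (simp add: same_kernel_def)

lemma same_kernel_append: "same_kernel a b \<Longrightarrow> c \<in> lists X \<Longrightarrow> same_kernel (a @ c) (b @ c)"
  unfolding same_kernel_def append_assoc by (metis append_in_lists_conv)

text \<open>
  The familiar inclusion of Green's relation \<open>\<L>\<close> in \<open>\<L>\<^sup>*\<close>.
\<close>

lemma same_kernel_mutual_left_multiples:
  assumes "nf (z @ a) = nf b" "nf (z' @ b) = nf a"
    and X: "z \<in> lists X" "z' \<in> lists X" "a \<in> lists X" "b \<in> lists X"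
  shows "same_kernel a b"
proof -
  have 1: "nf (b @ x) = nf (z @ a @ x)" "nf (a @ x) = nf (z' @ b @ x)" if "x \<in> lists X" for x
    using nf_cong[OF assms(1), of x x] nf_cong[OF assms(2), of x x] X that
    by (metis append.assoc append_in_lists_conv)+
  have "nf (b @ x) = nf (b @ y)" if "nf (a @ x) = nf (a @ y)" "x \<in> lists X" "y \<in> lists X" for x y
    unfolding 1(1)[OF that(2)] 1(1)[OF that(3)] using that(1) by simp
  moreover have "nf (a @ x) = nf (a @ y)" if "nf (b @ x) = nf (b @ y)" "x \<in> lists X" "y \<in> lists X" for x y
    unfolding 1(2)[OF that(2)] 1(2)[OF that(3)] using that(1) by simp
  ultimately show ?thesis unfolding same_kernel_def by blast
qed

lemma red_Inv_Rel: "t \<in> T \<Longrightarrow> red (Inv t) (Rel t) = Some (Obj (r t))"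
  using s_nonempty[of t] by (simp add: red_def)

lemma red_Obj_left: "y \<in> X \<Longrightarrow> red (Obj (src s r y)) y = Some y"
  using src_rng_nonempty[of y] by (cases "y = Zero") (auto simp: red_def)

lemma red_Obj_right: "x \<in> X \<Longrightarrow> red x (Obj (rng s r x)) = Some x"
  using src_rng_nonempty[of x] by (cases "x = Zero") (auto simp: red_def)

lemma same_kernel_Rel: "t \<in> T \<Longrightarrow> same_kernel [Rel t] [Obj (r t)]"
  using red_Obj_right[of "Rel t"]
  by (intro same_kernel_mutual_left_multiples[of "[Inv t]" _ _ "[Rel t]"]) (auto simp: red_Inv_Rel)

text \<open>
  If \<open>A\<close> is the source of \<open>y\<close>, it is an identity on \<open>y w\<close>. Otherwise it meets the source of
  every non-zero product \<open>y w x\<close> without being equal to it, so multiplication by \<open>A\<close> puts the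
  letter \<open>A\<close> in front of the reduced form of \<open>y w x\<close>, which is injective.
\<close>

lemma same_kernel_Obj_Cons:
  assumes A: "Obj A \<in> X" and y: "y \<in> X" and w: "w \<in> lists X" and ne: "A \<inter> src s r y \<noteq> {}"
  shows "same_kernel (Obj A # y # w) (y # w)"
proof (cases "A = src s r y")
  case True
  then have "nf (Obj A # y # w @ x) = nf (y # w @ x)" if "x \<in> lists X" for x
    using act_red[OF red_Obj_left A[unfolded True] y] y w that
    by (auto simp: foldr_act_in_X irred_foldr_act)
  then show ?thesis by (simp add: same_kernel_def)
next
  case False
  have step: "nf (Obj A # y # w @ x) = (if nf (y # w @ x) = [Zero] then [Zero] else Obj A # nf (y # w @ x))" for x
  proof (cases "nf (y # w @ x)")
    case (Cons z u)
    moreover have "z # u = [Zero] \<or> src s r z = src s r y"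
      using act_src[of y "nf (w @ x)"] Cons by simp
    moreover have "red (Obj A) z = None" if "src s r z = src s r y"
      using that ne False by (simp add: red_Obj)
    ultimately have "act (Obj A) (z # u) = (if z # u = [Zero] then [Zero] else Obj A # z # u)"
      by (cases "z # u = [Zero]") auto
    then show ?thesis using Cons by simp
  qed simp
  show ?thesis
    unfolding same_kernel_def append_Cons step by auto
qed

section \<open>The idempotents\<close>

abbreviation Invs :: "'t list \<Rightarrow> ('v, 't) letter list" where
  "Invs ts \<equiv> map Inv ts"

abbreviation Rels :: "'t list \<Rightarrow> ('v, 't) letter list" where
  "Rels ts \<equiv> map Rel (rev ts)"

lemma Invs_Rels_in_X [simp]:
  assumes "set ts \<subseteq> T"
  shows "Invs ts \<in> lists X" "Rels ts \<in> lists X"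
  using assms by (auto simp: subset_iff)

text \<open>
  \<open>Invs ts\<close> is the word \<open>v = t\<^sub>1\<^sup>-\<^sup>1 \<dots> t\<^sub>k\<^sup>-\<^sup>1\<close> and \<open>Rels ts\<close> is its inverse
  \<open>v\<^sup>* = t\<^sub>k \<dots> t\<^sub>1\<close>. The basic idempotents turn out to be the only ones that occur in the
  semigroup.
\<close>

definition basic_idempotent :: "('v, 't) letter list \<Rightarrow> bool" where
  "basic_idempotent e \<longleftrightarrow> e = [Zero] \<or> (\<exists>A. Obj A \<in> X \<and> e = [Obj A]) \<or>
    (\<exists>ts. ts \<noteq> [] \<and> set ts \<subseteq> T \<and> irred (Invs ts) \<and> e = Rels ts @ Invs ts)"

lemma irred_Inv_Cons:
  assumes "irred (Inv t # w)" "Inv t # w \<in> lists X"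
  shows "\<exists>ts. Inv t # w = Invs ts \<and> ts \<noteq> [] \<and> set ts \<subseteq> T"
  using assms
proof (induction w arbitrary: t)
  case Nil
  then show ?case by (intro exI[of _ "[t]"]) auto
next
  case (Cons y w)
  then obtain u where "y = Inv u"
    by (auto simp: red_def split: if_splits)
  with Cons obtain ts where "y # w = Invs ts" "set ts \<subseteq> T" by force
  with Cons.prems show ?case by (intro exI[of _ "t # ts"]) auto
qed

text \<open>
  The product telescopes from the middle: \<open>t\<^sub>k\<^sup>-\<^sup>1 t\<^sub>k = r(t\<^sub>k) = s(t\<^sub>k\<^sub>-\<^sub>1)\<close> is absorbed by the next
  relation, because reducedness of \<open>v\<close> says exactly that the ranges and sources fit.
\<close>

lemma nf_Invs_Rels:
  assumes "ts \<noteq> []" "set ts \<subseteq> T" "irred (Invs ts)"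
  shows "nf (Invs ts @ Rels ts) = [Obj (r (hd ts))]"
  using assms
proof (induction ts)
  case (Cons t ts)
  show ?case
  proof (cases ts)
    case Nil
    then show ?thesis using Cons.prems by (simp add: red_Inv_Rel)
  next
    case (Cons u us)
    have tu: "t \<in> T" "u \<in> T" "s t = r u" using Cons Cons.prems by (auto simp: red_def split: if_splits)
    have "nf (Invs ts @ Rels ts) = nf [Obj (s t)]"
      using Cons.IH Cons.prems Cons tu by simp
    from nf_cong[OF this HOL.refl, of "[Rel t]"]
    have "nf ((Invs ts @ Rels ts) @ [Rel t]) = nf ([Obj (s t)] @ [Rel t])"
      using Cons.prems tu by simp
    also have "\<dots> = [Rel t]"
      using tu red_Obj_left[of "Rel t"] by simp
    finally show ?thesis using tu by (simp add: red_Inv_Rel)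
  qed
qed simp

lemma Invs_regular:
  assumes "ts \<noteq> []" "set ts \<subseteq> T" "irred (Invs ts)"
  shows "nf (Invs ts @ Rels ts @ Invs ts) = nf (Invs ts)"
proof -
  obtain t us where ts: "ts = t # us" using assms(1) by (cases ts) auto
  have "nf ((Invs ts @ Rels ts) @ Invs ts) = nf ([Obj (r t)] @ Invs ts)"
    using nf_Invs_Rels[OF assms] assms(2) ts
    by (intro nf_cong) simp_all
  also have "\<dots> = nf (Invs ts)"
    using act_red[OF red_Obj_left[of "Inv t"], of "nf (Invs us)"] assms(2) ts
    by (simp add: foldr_act_in_X irred_foldr_act)
  finally show ?thesis by simp
qed

lemma basic_idempotent_words: "basic_idempotent e \<Longrightarrow> e \<in> words X"
  unfolding basic_idempotent_def by (elim disjE exE conjE) (simp_all add: words_iff)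

lemma basic_idempotent_idem:
  assumes "basic_idempotent e"
  shows "nf (e @ e) = nf e"
  using assms unfolding basic_idempotent_def
proof (elim disjE exE conjE)
  fix A assume "Obj A \<in> X" "e = [Obj A]"
  then show ?thesis using red_Obj_left[of "Obj A"] by simp
next
  fix ts assume ts: "ts \<noteq> []" "set ts \<subseteq> T" "irred (Invs ts)" "e = Rels ts @ Invs ts"
  then show ?thesis
    using nf_cong[OF HOL.refl Invs_regular[OF ts(1-3)], of "Rels ts"] by simp
qed simp

text \<open>
  Strip letters from the left of the reduced word. A relation \<open>t\<close> is first replaced by \<open>r(t)\<close>,
  which leaves vertex sets as the only letters to be removed. The process ends at an inverse
  letter, since then the whole remaining word consists of inverses, or at the last letter.
\<close>

lemma irred_same_kernel_basic_idempotent: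
  assumes "irred a" "a \<in> words X"
  shows "\<exists>e. basic_idempotent e \<and> same_kernel a e"
  using assms
proof (induction a)
  case Nil
  then show ?case by (simp add: words_iff)
next
  case (Cons x w)
  have x: "x \<in> X" and w: "w \<in> lists X" using Cons.prems by (auto simp: words_iff)
  have Obj_case: "\<exists>e. basic_idempotent e \<and> same_kernel (Obj A # w) e"
    if "Obj A \<in> X" "w \<noteq> [] \<Longrightarrow> A \<inter> src s r (hd w) \<noteq> {}" for A
  proof (cases w)
    case Nil
    then show ?thesis using that by (auto simp: basic_idempotent_def intro!: same_kernel_refl)
  next
    case (Cons y v)
    have "irred w" using Cons.prems(1) by (auto simp: successively_Cons)
    then obtain e where "basic_idempotent e" "same_kernel w e"
      using Cons.IH w Cons by (auto simp: words_iff)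
    moreover have "same_kernel (Obj A # w) w"
      using same_kernel_Obj_Cons[of A y v] that w Cons by simp
    ultimately show ?thesis using same_kernel_trans by blast
  qed
  have ne: "rng s r x \<inter> src s r (hd w) \<noteq> {}" if "w \<noteq> []"
    using Cons.prems(1) that by (auto simp: successively_Cons red_def split: if_splits)
  show ?case
  proof (cases x)
    case (Rel t)
    then have "same_kernel ([Rel t] @ w) ([Obj (r t)] @ w)"
      using same_kernel_append[OF same_kernel_Rel] x w by simp
    moreover obtain e where "basic_idempotent e" "same_kernel (Obj (r t) # w) e"
      using Obj_case[of "r t"] ne x Rel by auto
    ultimately show ?thesis using same_kernel_trans Rel by auto
  next
    case (Obj A)
    then show ?thesis using Obj_case[of A] ne x by auto
  next
    case (Inv t)
    then have "irred (Inv t # w)" "Inv t # w \<in> lists X" using Cons.prems(1) x w by simp_all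
    from irred_Inv_Cons[OF this] obtain ts where ts: "Inv t # w = Invs ts" "ts \<noteq> []" "set ts \<subseteq> T"
      by (elim exE conjE) (rule that)
    have irr: "irred (Invs ts)" using Cons.prems(1) Inv ts(1) by metis
    have "same_kernel (Invs ts) (Rels ts @ Invs ts)"
      using ts irr by (intro same_kernel_mutual_left_multiples[of "Rels ts" _ _ "Invs ts"] Invs_regular) simp_all
    then show ?thesis using ts irr Inv unfolding basic_idempotent_def by metis
  next
    case Zero
    then have "w = []" using Cons.prems(1) by (cases w) auto
    then show ?thesis using Zero by (auto simp: basic_idempotent_def intro!: same_kernel_refl)
  qed
qed

lemma same_kernel_basic_idempotent:
  assumes "a \<in> words X"
  shows "\<exists>e. basic_idempotent e \<and> same_kernel a e"
proof -
  have a: "a \<in> lists X" "a \<noteq> []" using assms by (auto simp: words_iff)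
  have "nf a \<noteq> []" using a by (cases a) auto
  then obtain e where e: "basic_idempotent e" "same_kernel (nf a) e"
    using irred_same_kernel_basic_idempotent[of "nf a"] irred_nf nf_in_X a by (auto simp: words_iff)
  have "same_kernel a (nf a)"
    using a nf_irred[OF irred_nf] 
    by (intro same_kernel_mutual_left_multiples[of "[]" _ _ "[]"]) (auto simp: nf_in_X)
  with e show ?thesis using same_kernel_trans by blast
qed

text \<open>
  An inverse letter \<open>t\<^sup>-\<^sup>1\<close> that is no longer visible at the front of a non-zero product must
  have been cancelled by an initial \<open>t\<close> of \<open>w\<close>; all other rules either keep it or give zero.
\<close>

lemma act_Inv_solve:
  assumes "act (Inv t) w = h" "h \<noteq> [Zero]" "\<And>u. hd h \<noteq> Inv u"
    and "t \<in> T" "w \<in> lists X" "irred w"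
  shows "w = act (Rel t) h"
proof (cases w)
  case Nil
  then show ?thesis using assms(1) assms(3)[of t] by auto
next
  case (Cons y v)
  have v: "v \<in> lists X" "irred v" using assms Cons by (auto simp: successively_Cons)
  show ?thesis
  proof (cases "y = Rel t")
    case True
    then have "h = act (Obj (r t)) v"
      using assms Cons by (simp add: red_Inv_Rel)
    then have "act (Rel t) h = act (Rel t) v"
      using act_red[OF red_Obj_right[of "Rel t"], of v] assms(4) v by simp
    also have "\<dots> = w" using assms(6) Cons True by (simp add: act_irred)
    finally show ?thesis by simp
  next
    case False
    have "red (Inv t) y \<noteq> None"
      using assms(1) assms(3)[of t] Cons by (cases "red (Inv t) y") auto
    moreover have "red (Inv t) y \<noteq> Some Zero" using assms(1,2) Cons by auto
    ultimately have y: "y = Obj (s t)" using False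
      by (cases y) (auto simp: red_def split: if_splits)
    then have h: "h = act (Inv t) v"
      using assms Cons red_Obj_right[of "Inv t"] by simp
    show ?thesis
    proof (cases v)
      case Nil
      then show ?thesis using h assms(3)[of t] by simp
    next
      case v_Cons: (Cons z v')
      have "red (Obj (s t)) z = None" using assms(6) Cons v_Cons y by simp
      then have "src s r z \<noteq> s t" by (auto simp: red_Obj split: if_splits)
      then have "red (Inv t) z = Some Zero" using red_Inv[OF assms(4)] by simp
      then show ?thesis using h v_Cons assms(2) by simp
    qed
  qed
qed

lemma act_Rel_hd: "act (Rel t) w = [Zero] \<or> hd (act (Rel t) w) = Rel t"
proof (induction w)
  case (Cons y w)
  have "red (Rel t) y \<in> {None, Some Zero, Some (Rel t)}"
    by (cases y) (auto simp: red_def)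
  then show ?case using Cons by auto
qed simp

text \<open>
  Iterating the previous solution: each intermediate product starts with a relation, hence
  again not with an inverse letter.
\<close>

lemma nf_Invs_solve:
  assumes "nf (Invs ts @ g) = h" "h \<noteq> [Zero]" "\<And>u. hd h \<noteq> Inv u"
    and "set ts \<subseteq> T" "g \<in> lists X"
  shows "nf g = foldr act (Rels ts) h"
  using assms
proof (induction ts arbitrary: h)
  case Nil
  then show ?case by simp
next
  case (Cons t ts)
  let ?w = "nf (Invs ts @ g)"
  have w: "?w \<in> lists X" "irred ?w"
    using Cons.prems by (simp_all add: foldr_act_in_X irred_foldr_act)
  have eq: "?w = act (Rel t) h"
    using Cons.prems w by (intro act_Inv_solve) auto
  have "?w \<noteq> [Zero]" using Cons.prems(1,2) by auto
  then have "nf g = foldr act (Rels ts) (act (Rel t) h)"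
    using eq act_Rel_hd[of t h] Cons.prems by (intro Cons.IH) auto
  then show ?case by simp
qed

lemma nf_append_Zero: "nf (u @ [Zero]) = [Zero]"
  by (induction u) auto

text \<open>
  In the case \<open>e = v\<^sup>* v\<close>, the unknown \<open>f v\<^sup>*\<close> is recovered from \<open>v (f v\<^sup>*) = v v\<^sup>*\<close>, whose value
  is a vertex set and so does not begin with an inverse letter.
\<close>

lemma basic_idempotent_unique:
  assumes e: "basic_idempotent e" and f: "f \<in> words X"
    and fe: "nf (f @ e) = nf f" and ef: "nf (e @ f) = nf e"
  shows "nf f = nf e"
  using e unfolding basic_idempotent_def
proof (elim disjE exE conjE)
  assume e: "e = [Zero]"
  then have "nf f = nf (f @ [Zero])" using fe by simp
  also have "\<dots> = [Zero]" by (rule nf_append_Zero)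
  finally show ?thesis using e by simp
next
  fix A assume A: "Obj A \<in> X" "e = [Obj A]"
  then have eq: "act (Obj A) (nf f) = [Obj A]" using ef by simp
  show ?thesis
  proof (cases "nf f")
    case Nil
    then show ?thesis using f by (cases f) (auto simp: words_iff)
  next
    case (Cons y g)
    have "act y g = y # g" using irred_nf[of f] Cons by (auto intro: act_irred)
    then show ?thesis using eq A Cons by (auto simp: red_Obj split: if_splits)
  qed
next
  fix ts assume ts: "ts \<noteq> []" "set ts \<subseteq> T" "irred (Invs ts)" and e_def: "e = Rels ts @ Invs ts"
  let ?v = "Invs ts" and ?v' = "Rels ts"
  have X: "?v \<in> lists X" "?v' \<in> lists X" "e \<in> lists X" "f \<in> lists X"
    using ts f e_def by (simp_all add: words_iff)
  have ve: "nf (?v @ e) = nf ?v"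
    using Invs_regular[OF ts] e_def by simp
  have "nf (?v @ f) = nf ((?v @ e) @ f)"
    using X ve by (intro nf_cong) auto
  also have "\<dots> = nf (?v @ (e @ f))" by simp
  also have "\<dots> = nf (?v @ e)"
    using X ef by (intro nf_cong) auto
  finally have vf: "nf (?v @ f) = nf ?v" using ve by simp
  have "nf (?v @ (f @ ?v')) = nf ((?v @ f) @ ?v')" by simp
  also have "\<dots> = nf (?v @ ?v')"
    using X vf by (intro nf_cong) auto
  also have "\<dots> = [Obj (r (hd ts))]"
    by (rule nf_Invs_Rels[OF ts])
  finally have "nf (f @ ?v') = foldr act ?v' [Obj (r (hd ts))]"
    using ts X by (intro nf_Invs_solve) auto
  also have "\<dots> = nf (?v' @ ?v @ ?v')"
    using nf_Invs_Rels[OF ts] by simp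
  finally have fv: "nf (f @ ?v') = nf (?v' @ ?v @ ?v')" .
  have "nf f = nf ((f @ ?v') @ ?v)"
    using fe e_def by simp
  also have "\<dots> = nf ((?v' @ ?v @ ?v') @ ?v)"
    using X by (intro nf_cong[OF fv HOL.refl]) simp_all
  also have "\<dots> = nf (?v' @ (?v @ ?v' @ ?v))" by simp
  also have "\<dots> = nf (?v' @ ?v)"
    using X by (intro nf_cong[OF HOL.refl Invs_regular[OF ts]]) simp_all
  finally show ?thesis using e_def by simp
qed

section \<open>The network semigroup\<close>

abbreviation cls :: "('v, 't) letter list \<Rightarrow> ('v, 't) letter list set" where
  "cls u \<equiv> gen_cong X R `` {u}"

lemma carrier_Q: "carrier (Q V T s r) = cls ` words X"
  by (auto simp: Q_def presented_sgrp_def quotient_def)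

lemma mul_cls: "u \<in> words X \<Longrightarrow> v \<in> words X \<Longrightarrow> cls u \<odot>\<^bsub>Q V T s r\<^esub> cls v = cls (u @ v)"
  by (simp add: Q_def presented_sgrp_mul)

lemma cls_eq_iff:
  assumes "u \<in> words X" "v \<in> words X"
  shows "cls u = cls v \<longleftrightarrow> nf u = nf v"
  using assms gen_cong_iff_nf eq_equiv_class_iff[OF equiv_gen_cong] by metis

text \<open>
  Every element of \<open>S\<^sup>1\<close> comes from a possibly empty word. If the semigroup has an identity of
  its own, the empty word represents nothing in \<open>S\<^sup>1\<close>, which does no harm, as \<open>same_kernel\<close> is
  then merely the stronger condition.
\<close>

lemma same_kernel_Lstar:
  assumes "same_kernel a b" "a \<in> words X" "b \<in> words X"
  shows "(cls a, cls b) \<in> Lstar (Q V T s r)"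
proof -
  let ?Q1 = "adjoin_one (Q V T s r)"
  let ?emb = "\<lambda>x. if x = [] then None else Some (cls x)"
  have mul: "Some (cls c) \<odot>\<^bsub>?Q1\<^esub> ?emb x = Some (cls (c @ x))"
    if "c \<in> words X" "x \<in> lists X" for c x
    using that by (auto simp: adjoin_one_def mul_cls words_iff)
  have eq: "Some (cls c) \<odot>\<^bsub>?Q1\<^esub> ?emb x = Some (cls c) \<odot>\<^bsub>?Q1\<^esub> ?emb y \<longleftrightarrow> nf (c @ x) = nf (c @ y)"
    if "c \<in> words X" "x \<in> lists X" "y \<in> lists X" for c x y
    unfolding mul[OF that(1,2)] mul[OF that(1,3)] option.inject
    using that by (intro cls_eq_iff) (auto simp: words_iff)
  have carrier: "\<exists>u\<in>lists X. x = ?emb u" if x: "x \<in> carrier ?Q1" for x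
  proof (cases x)
    case None
    then show ?thesis by (intro bexI[of _ "[]"]) auto
  next
    case (Some c)
    then obtain u where "u \<in> words X" "c = cls u"
      using x by (auto simp: adjoin_one_def carrier_Q split: if_splits)
    then show ?thesis using Some by (intro bexI[of _ u]) (auto simp: words_iff)
  qed
  have "Some (cls a) \<odot>\<^bsub>?Q1\<^esub> x = Some (cls a) \<odot>\<^bsub>?Q1\<^esub> y \<longleftrightarrow>
      Some (cls b) \<odot>\<^bsub>?Q1\<^esub> x = Some (cls b) \<odot>\<^bsub>?Q1\<^esub> y"
    if xy: "x \<in> carrier ?Q1" "y \<in> carrier ?Q1" for x y
  proof -
    obtain u v where uv: "u \<in> lists X" "v \<in> lists X" "x = ?emb u" "y = ?emb v"
      using carrier[OF xy(1)] carrier[OF xy(2)] by blast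
    show ?thesis
      unfolding uv(3,4) eq[OF assms(2) uv(1,2)] eq[OF assms(3) uv(1,2)]
      using assms(1) uv(1,2) unfolding same_kernel_def by blast
  qed
  then show ?thesis
    using assms by (auto simp: Lstar_def carrier_Q)
qed

lemma right_star_abundant_Q: "right_star_abundant (Q V T s r)"
proof -
  let ?Q = "Q V T s r"
  have "\<exists>!e. e \<in> C \<inter> idempotents ?Q" if C: "C \<in> carrier ?Q // Lstar ?Q" for C
  proof -
    obtain a where a: "a \<in> words X" "C = Lstar ?Q `` {cls a}"
      using C by (auto simp: quotient_def carrier_Q)
    obtain e where e: "basic_idempotent e" "same_kernel a e"
      using same_kernel_basic_idempotent[OF a(1)] by blast
    have ew: "e \<in> words X" using e(1) by (rule basic_idempotent_words)
    have ae: "(cls a, cls e) \<in> Lstar ?Q"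
      using same_kernel_Lstar e a ew by blast
    have "cls (e @ e) = cls e"
      using basic_idempotent_idem[OF e(1)] ew by (simp add: cls_eq_iff words_append del: foldr_append)
    then have e_idem: "cls e \<in> idempotents ?Q"
      using ew by (simp add: idempotents_def carrier_Q mul_cls)
    show ?thesis
    proof (rule ex1I[of _ "cls e"])
      show "cls e \<in> C \<inter> idempotents ?Q" using ae e_idem a by blast
    next
      fix F assume F: "F \<in> C \<inter> idempotents ?Q"
      then obtain f where f: "f \<in> words X" "F = cls f"
        by (auto simp: idempotents_def carrier_Q)
      have L: "(cls e, F) \<in> Lstar ?Q" "(F, cls e) \<in> Lstar ?Q"
        using ae F a(2) by (auto simp: Lstar_def)
      have "F \<odot>\<^bsub>?Q\<^esub> cls e = F"
        by (rule Lstar_idempotent_right_identity[OF L(1) e_idem])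
      moreover have "cls e \<odot>\<^bsub>?Q\<^esub> F = cls e"
        using F by (intro Lstar_idempotent_right_identity[OF L(2)]) blast
      ultimately have "nf (f @ e) = nf f" "nf (e @ f) = nf e"
        using f ew by (simp_all add: mul_cls cls_eq_iff words_append del: foldr_append)
      then have "nf f = nf e"
        using basic_idempotent_unique[OF e(1) f(1)] by blast
      then show "F = cls e" using f ew by (simp add: cls_eq_iff)
    qed
  qed
  then show ?thesis
    by (simp add: right_star_abundant_def Q_def sgrp_presented_sgrp)
qed

lemma is_zero_Q: "is_zero (Q V T s r) (cls [Zero])"
proof -
  have Zero: "[Zero] \<in> words X" by (simp add: words_iff)
  have "cls ([Zero] @ u) = cls [Zero]" "cls (u @ [Zero]) = cls [Zero]" if "u \<in> words X" for u
    using that Zero nf_append_Zero[of u]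
    by (simp_all add: cls_eq_iff words_append del: foldr_append append.simps) simp
  then show ?thesis
    using Zero by (auto simp: is_zero_def carrier_Q mul_cls)
qed

end

theorem theorem3p14:
  fixes V :: "'v set" and T :: "'t set" and s r :: "'t \<Rightarrow> 'v set"
  assumes "network V T s r"
  shows "sgrp (Q V T s r) \<and> right_star_abundant (Q V T s r) \<and> (\<exists>z. is_zero (Q V T s r) z)"
proof -
  interpret network V T s r by (rule assms)
  show ?thesis
    using right_star_abundant_Q is_zero_Q by (auto simp: right_star_abundant_def)
qed

end
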